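(* Let $d\ge1$ and let $\boldsymbol\rho=(\rho_1,\dots,\rho_d)\in B_d\setminus\{\boldsymbol 0\}$. Put \[ R_{\boldsymbol\rho}=\sum_{j=1}^d\rho_j,\qquad Q(\boldsymbol\rho)=\frac{\sum_{j=1}^d\rho_j^2}{\left(\sum_{j=1}^d\rho_j\right)^2},\qquad \lambda(R_{\boldsymbol\rho})=\frac{2}{1+\sqrt{1-R_{\boldsymbol\rho}^2}} . \] Then \[ \lambda(R_{\boldsymbol\rho})-\|\mathcal H_{\boldsymbol\rho}\|\ \ge\ (1-Q(\boldsymbol\rho))\,(\lambda(R_{\boldsymbol\rho})-1). \] Consequently, $\|\mathcal H_{\boldsymbol\rho}\|=\lambda(R_{\boldsymbol\rho})$ if and only if at most one component of $\boldsymbol\rho$ is nonzero.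
   Context: $B_d=\{\boldsymbol\rho=(\rho_1,\dots,\rho_d)\in[0,1]^d:\rho_1+\cdots+\rho_d\le1\}$. For $\alpha\in\mathbb N_0^d$, $|\alpha|=\sum_j\alpha_j$ and $\alpha!=\prod_j\alpha_j!$; $0^0=1$. The operator $\mathcal H_{\boldsymbol\rho}$ is the bounded operator on $\ell^2(\mathbb N_0^d)$ with matrix entries \[ (\mathcal H_{\boldsymbol\rho})_{\alpha,\beta}=(-1)^{|\alpha|+|\beta|}\frac{(|\alpha|+|\beta|)!}{\alpha!\,\beta!}\prod_{j=1}^d\left(\frac{\rho_j}{2}\right)^{\alpha_j+\beta_j},\qquad \alpha,\beta\in\mathbb N_0^d, \] and $\|\mathcal H_{\boldsymbol\rho}\|$ is its operator norm. *)

theory Defs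
  imports "HOL-Analysis.Analysis"
begin

section \<open>The complex Hilbert space of square-summable families\<close>

typedef 'a ell2 = "{f :: 'a \<Rightarrow> complex. (\<lambda>i. (norm (f i))\<^sup>2) summable_on UNIV}"
  morphisms ell2_nth Abs_ell2
  by (rule exI[of _ "\<lambda>_. 0"]) simp

setup_lifting type_definition_ell2

lemma ell2_nth_summable: "(\<lambda>i. (norm (ell2_nth x i))\<^sup>2) summable_on UNIV"
  using ell2_nth[of x] by simp

lemma ell2_eqI: "(\<And>i. ell2_nth x i = ell2_nth y i) \<Longrightarrow> x = y"
  by (simp add: ell2_nth_inject[symmetric] fun_eq_iff)

lemma square_summable_add:
  fixes f g :: "'a \<Rightarrow> complex"
  assumes "(\<lambda>i. (norm (f i))\<^sup>2) summable_on UNIV" "(\<lambda>i. (norm (g i))\<^sup>2) summable_on UNIV"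
  shows "(\<lambda>i. (norm (f i + g i))\<^sup>2) summable_on UNIV"
proof (rule summable_on_comparison_test)
  show "(\<lambda>i. 2 * (norm (f i))\<^sup>2 + 2 * (norm (g i))\<^sup>2) summable_on UNIV"
    using assms by (intro summable_on_add summable_on_cmult_right)
  fix i
  have "(norm (f i + g i))\<^sup>2 \<le> (norm (f i) + norm (g i))\<^sup>2"
    by (intro power_mono norm_triangle_ineq) auto
  also have "\<dots> \<le> 2 * (norm (f i))\<^sup>2 + 2 * (norm (g i))\<^sup>2"
    using sum_squares_bound[of "norm (f i)" "norm (g i)"] by (simp add: power2_sum)
  finally show "(norm (f i + g i))\<^sup>2 \<le> 2 * (norm (f i))\<^sup>2 + 2 * (norm (g i))\<^sup>2" .
qed auto

lemma square_summable_scale: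
  fixes f :: "'a \<Rightarrow> complex"
  assumes "(\<lambda>i. (norm (f i))\<^sup>2) summable_on UNIV"
  shows "(\<lambda>i. (norm (c * f i))\<^sup>2) summable_on UNIV"
  using summable_on_cmult_right[OF assms, of "(norm c)\<^sup>2"]
  by (simp add: norm_mult power_mult_distrib)

lemma square_summable_inner:
  fixes f g :: "'a \<Rightarrow> complex"
  assumes "(\<lambda>i. (norm (f i))\<^sup>2) summable_on UNIV" "(\<lambda>i. (norm (g i))\<^sup>2) summable_on UNIV"
  shows "(\<lambda>i. inner (f i) (g i)) summable_on UNIV"
proof (rule abs_summable_summable, rule summable_on_comparison_test)
  show "(\<lambda>i. (norm (f i))\<^sup>2 + (norm (g i))\<^sup>2) summable_on UNIV"
    using assms by (rule summable_on_add)
  fix i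
  have "norm (inner (f i) (g i)) \<le> norm (f i) * norm (g i)"
    by (simp add: Cauchy_Schwarz_ineq2)
  also have "\<dots> \<le> (norm (f i))\<^sup>2 + (norm (g i))\<^sup>2"
    using sum_squares_bound[of "norm (f i)" "norm (g i)"]
      mult_nonneg_nonneg[of "norm (f i)" "norm (g i)"] norm_ge_zero[of "f i"] norm_ge_zero[of "g i"]
    by linarith
  finally show "norm (inner (f i) (g i)) \<le> (norm (f i))\<^sup>2 + (norm (g i))\<^sup>2" .
qed auto

text \<open>
  The library class \<open>real_inner\<close> is real, so the real inner product below is the real part of the
  usual Hermitian one; the norm it induces is the usual \<open>\<ell>\<^sup>2\<close> norm. Scalar multiplication by
  complex numbers is provided separately.
\<close>

instantiation ell2 :: (type) real_inner
begin

lift_definition zero_ell2 :: "'a ell2" is "\<lambda>_. 0" by simp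

lift_definition plus_ell2 :: "'a ell2 \<Rightarrow> 'a ell2 \<Rightarrow> 'a ell2" is "\<lambda>f g i. f i + g i"
  by (simp add: square_summable_add)

lift_definition uminus_ell2 :: "'a ell2 \<Rightarrow> 'a ell2" is "\<lambda>f i. - f i" by simp

lift_definition minus_ell2 :: "'a ell2 \<Rightarrow> 'a ell2 \<Rightarrow> 'a ell2" is "\<lambda>f g i. f i - g i"
  subgoal for f g using square_summable_add[of f "\<lambda>i. - g i"] by simp
  done

lift_definition scaleR_ell2 :: "real \<Rightarrow> 'a ell2 \<Rightarrow> 'a ell2" is "\<lambda>r f i. r *\<^sub>R f i"
  subgoal for r f using square_summable_scale[of f "of_real r"] by (simp add: scaleR_conv_of_real)
  done

definition inner_ell2 :: "'a ell2 \<Rightarrow> 'a ell2 \<Rightarrow> real" where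
  "inner_ell2 x y = (\<Sum>\<^sub>\<infinity>i. inner (ell2_nth x i) (ell2_nth y i))"

definition norm_ell2 :: "'a ell2 \<Rightarrow> real" where
  "norm_ell2 x = sqrt (\<Sum>\<^sub>\<infinity>i. (norm (ell2_nth x i))\<^sup>2)"

definition dist_ell2 :: "'a ell2 \<Rightarrow> 'a ell2 \<Rightarrow> real" where
  "dist_ell2 x y = norm (x - y)"

definition sgn_ell2 :: "'a ell2 \<Rightarrow> 'a ell2" where
  "sgn_ell2 x = scaleR (inverse (norm x)) x"

definition uniformity_ell2 :: "('a ell2 \<times> 'a ell2) filter" where
  "uniformity_ell2 = (INF e\<in>{0<..}. principal {(x, y). dist x y < e})"

definition open_ell2 :: "'a ell2 set \<Rightarrow> bool" where
  "open_ell2 U \<longleftrightarrow> (\<forall>x\<in>U. eventually (\<lambda>(x', y). x' = x \<longrightarrow> y \<in> U) uniformity)"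

instance
proof
  fix x y z :: "'a ell2" and r s :: real
  show "x + y + z = x + (y + z)" by transfer (simp add: add.assoc)
  show "x + y = y + x" by transfer (simp add: add.commute)
  show "0 + x = x" by transfer simp
  show "- x + x = 0" by transfer simp
  show "x - y = x + - y" by transfer simp
  show "r *\<^sub>R (x + y) = r *\<^sub>R x + r *\<^sub>R y" by transfer (simp add: scaleR_add_right)
  show "(r + s) *\<^sub>R x = r *\<^sub>R x + s *\<^sub>R x" by transfer (simp add: scaleR_add_left)
  show "r *\<^sub>R s *\<^sub>R x = (r * s) *\<^sub>R x" by transfer simp
  show "1 *\<^sub>R x = x" by transfer simp
  show "dist x y = norm (x - y)" by (simp add: dist_ell2_def)
  show "sgn x = scaleR (inverse (norm x)) x" by (simp add: sgn_ell2_def)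
  show "uniformity = (INF e\<in>{0<..}. principal {(x, y :: 'a ell2). dist x y < e})"
    by (rule uniformity_ell2_def)
  show "open U \<longleftrightarrow> (\<forall>x\<in>U. eventually (\<lambda>(x', y). x' = x \<longrightarrow> y \<in> U) uniformity)"
    for U :: "'a ell2 set" by (rule open_ell2_def)
  show "inner x y = inner y x" by (simp add: inner_ell2_def inner_commute)
  have summ: "(\<lambda>i. inner (ell2_nth u i) (ell2_nth v i)) summable_on UNIV" for u v :: "'a ell2"
    by (intro square_summable_inner ell2_nth_summable)
  show "inner (x + y) z = inner x z + inner y z"
    by (simp add: inner_ell2_def plus_ell2.rep_eq inner_add_left infsum_add[OF summ summ])
  show "inner (r *\<^sub>R x) y = r * inner x y"
    by (simp add: inner_ell2_def scaleR_ell2.rep_eq infsum_cmult_right[OF summ])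
  show "0 \<le> inner x x" by (simp add: inner_ell2_def infsum_nonneg)
  show "inner x x = 0 \<longleftrightarrow> x = 0"
  proof
    assume "inner x x = 0"
    then have "inner (ell2_nth x i) (ell2_nth x i) = 0" for i
      using nonneg_infsum_le_0D[OF _ summ[of x x], of i] by (auto simp: inner_ell2_def)
    then show "x = 0" by (intro ell2_eqI) (simp add: zero_ell2.rep_eq)
  qed (simp add: inner_ell2_def zero_ell2.rep_eq)
  show "norm x = sqrt (inner x x)"
    by (simp add: norm_ell2_def inner_ell2_def power2_norm_eq_inner)
qed

end

lift_definition scaleC_ell2 :: "complex \<Rightarrow> 'a ell2 \<Rightarrow> 'a ell2" is "\<lambda>c f i. c * f i"
  by (simp add: square_summable_scale)

lift_definition basis_ell2 :: "'a \<Rightarrow> 'a ell2" is "\<lambda>i j. if j = i then 1 else 0"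
  subgoal for i
    by (rule finite_nonzero_values_imp_summable_on, rule finite_subset[of _ "{i}"]) (auto split: if_splits)
  done


section \<open>The operator\<close>

text \<open>Multi-indices are functions on the finite index type, whose cardinality is the dimension.\<close>

type_synonym 'd multi = "'d \<Rightarrow> nat"

definition multi_size :: "'d::finite multi \<Rightarrow> nat" where
  "multi_size \<alpha> = (\<Sum>j\<in>UNIV. \<alpha> j)"

definition multi_fact :: "'d::finite multi \<Rightarrow> nat" where
  "multi_fact \<alpha> = (\<Prod>j\<in>UNIV. fact (\<alpha> j))"

definition B_set :: "(real ^ 'd::finite) set" where
  "B_set = {\<rho>. (\<forall>j. 0 \<le> \<rho> $ j \<and> \<rho> $ j \<le> 1) \<and> (\<Sum>j\<in>UNIV. \<rho> $ j) \<le> 1}"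

definition H_entry :: "real ^ 'd::finite \<Rightarrow> 'd multi \<Rightarrow> 'd multi \<Rightarrow> real" where
  "H_entry \<rho> \<alpha> \<beta> =
     (-1) ^ (multi_size \<alpha> + multi_size \<beta>)
     * (fact (multi_size \<alpha> + multi_size \<beta>) / (real (multi_fact \<alpha>) * real (multi_fact \<beta>)))
     * (\<Prod>j\<in>UNIV. (\<rho> $ j / 2) ^ (\<alpha> j + \<beta> j))"

text \<open>
  The type \<open>\<Rightarrow>\<^sub>L\<close> consists of the bounded real-linear maps, so complex linearity is demanded
  explicitly; without it the values on the basis vectors would not determine the operator.
\<close>

definition has_matrix :: "('a ell2 \<Rightarrow>\<^sub>L 'a ell2) \<Rightarrow> ('a \<Rightarrow> 'a \<Rightarrow> complex) \<Rightarrow> bool" where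
  "has_matrix T m \<longleftrightarrow>
     (\<forall>c x. blinfun_apply T (scaleC_ell2 c x) = scaleC_ell2 c (blinfun_apply T x)) \<and>
     (\<forall>\<alpha> \<beta>. ell2_nth (blinfun_apply T (basis_ell2 \<beta>)) \<alpha> = m \<alpha> \<beta>)"

definition H_op :: "real ^ 'd::finite \<Rightarrow> 'd multi ell2 \<Rightarrow>\<^sub>L 'd multi ell2" where
  "H_op \<rho> = (THE T. has_matrix T (\<lambda>\<alpha> \<beta>. complex_of_real (H_entry \<rho> \<alpha> \<beta>)))"

definition R_sum :: "real ^ 'd::finite \<Rightarrow> real" where
  "R_sum \<rho> = (\<Sum>j\<in>UNIV. \<rho> $ j)"

definition Q_quot :: "real ^ 'd::finite \<Rightarrow> real" where
  "Q_quot \<rho> = (\<Sum>j\<in>UNIV. (\<rho> $ j)\<^sup>2) / (\<Sum>j\<in>UNIV. \<rho> $ j)\<^sup>2"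

definition lam :: "real \<Rightarrow> real" where
  "lam R = 2 / (1 + sqrt (1 - R\<^sup>2))"

end

theory Submission
  imports Defs
begin

text \<open>
  Put \<open>r = \<rho> / 2\<close>, \<open>s = R / 2\<close> and \<open>w(\<alpha>) = |\<alpha>|!/\<alpha>! r^\<alpha>\<close>. By Vandermonde's identity the matrix is \<open>K K\<^sup>T\<close> for
  \<open>K(\<alpha>, k) = (-1)^|\<alpha>| w(\<alpha>) (|\<alpha>| choose k)\<close>, so that the norm of the operator is the square of the norm
  of \<open>K\<close>. Now \<open>\<parallel>K y\<parallel>\<^sup>2 = \<Sum>m. W(m) |\<Sum>k. (m choose k) y(k)|\<^sup>2\<close> with \<open>W(m) = \<Sum>|\<alpha>| = m. w(\<alpha>)\<^sup>2\<close>. Here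
  \<open>W(0) = 1\<close>, and \<open>W(m) \<le> Q s^(2 m)\<close> for \<open>m \<ge> 1\<close>, because the collision probability of a multinomial
  distribution does not increase with the number of trials. Schur's test bounds the one-dimensional
  matrix \<open>s^m (m choose k)\<close> by \<open>\<lambda>(R)\<close> in squared norm, hence \<open>\<parallel>K\<parallel>\<^sup>2 \<le> Q \<lambda>(R) + (1 - Q)\<close>, which is the
  asserted inequality. Since \<open>\<lambda>(R) > 1\<close>, equality of the norm with \<open>\<lambda>(R)\<close> forces \<open>Q = 1\<close>; conversely, if a
  single component is nonzero, geometric vectors have Rayleigh quotients approaching \<open>\<lambda>(R)\<close>.
\<close>

section \<open>Gram operators of row-finite kernels\<close>

lemma ell2_norm_square: "(norm x)\<^sup>2 = (\<Sum>\<^sub>\<infinity>i. (norm (ell2_nth x i))\<^sup>2)"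
  by (simp add: norm_ell2_def infsum_nonneg)

lemma square_summable_mult:
  fixes f g :: "'a \<Rightarrow> complex"
  assumes "(\<lambda>i. (norm (f i))\<^sup>2) summable_on UNIV" "(\<lambda>i. (norm (g i))\<^sup>2) summable_on UNIV"
  shows "(\<lambda>i. f i * g i) summable_on UNIV"
proof (rule abs_summable_summable, rule summable_on_comparison_test)
  show "(\<lambda>i. (norm (f i))\<^sup>2 + (norm (g i))\<^sup>2) summable_on UNIV"
    using assms by (rule summable_on_add)
  fix i
  show "norm (f i * g i) \<le> (norm (f i))\<^sup>2 + (norm (g i))\<^sup>2"
    using sum_squares_bound[of "norm (f i)" "norm (g i)"]
      mult_nonneg_nonneg[of "norm (f i)" "norm (g i)"] norm_ge_zero[of "f i"] norm_ge_zero[of "g i"]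
    unfolding norm_mult by linarith
qed auto

lemma has_sum_sum:
  fixes f :: "'i \<Rightarrow> 'a \<Rightarrow> 'b :: topological_comm_monoid_add"
  assumes "\<And>i. i \<in> I \<Longrightarrow> (f i has_sum s i) A"
  shows "((\<lambda>x. \<Sum>i\<in>I. f i x) has_sum (\<Sum>i\<in>I. s i)) A"
  using assms by (induction I rule: infinite_finite_induct) (auto intro: has_sum_add)

lemma ell2_nth_sum: "ell2_nth (sum f F) i = (\<Sum>j\<in>F. ell2_nth (f j) i)"
  by (induction F rule: infinite_finite_induct) (simp_all add: zero_ell2.rep_eq plus_ell2.rep_eq)

lemma has_sum_finite_support:
  assumes "finite F" "\<And>x. x \<notin> F \<Longrightarrow> f x = 0"
  shows "(f has_sum (\<Sum>x\<in>F. f x)) UNIV"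
  using has_sum_cong_neutral[of UNIV F f f] has_sum_finite[OF assms(1), of f] assms(2) by auto

section \<open>Uniqueness of a bounded operator with a given matrix\<close>

text \<open>Pythagoras: the truncation to \<open>F\<close> and the remaining tail have disjoint
  supports. It measures how well finite combinations of basis vectors approximate
  \<open>x\<close>.\<close>

lemma norm_ell2_diff_partial:
  assumes "finite F"
  shows "(norm (x - (\<Sum>i\<in>F. scaleC_ell2 (ell2_nth x i) (basis_ell2 i))))\<^sup>2
      = (norm x)\<^sup>2 - (\<Sum>i\<in>F. (norm (ell2_nth x i))\<^sup>2)"
proof -
  let ?y = "\<Sum>i\<in>F. scaleC_ell2 (ell2_nth x i) (basis_ell2 i)"
  let ?f = "\<lambda>i. if i \<in> F then (norm (ell2_nth x i))\<^sup>2 else 0"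
  have y: "ell2_nth ?y i = (if i \<in> F then ell2_nth x i else 0)" for i
    using assms by (simp add: ell2_nth_sum scaleC_ell2.rep_eq basis_ell2.rep_eq
        if_distrib[of "\<lambda>z. _ * z"] cong: if_cong)
  have "((\<lambda>i. (norm (ell2_nth x i))\<^sup>2) has_sum (norm x)\<^sup>2) UNIV"
    unfolding ell2_norm_square by (rule has_sum_infsum[OF ell2_nth_summable])
  moreover have "((\<lambda>i. - ?f i) has_sum - (\<Sum>i\<in>F. (norm (ell2_nth x i))\<^sup>2)) UNIV"
    using has_sum_finite_support[OF assms, of ?f] by (simp add: has_sum_uminus)
  ultimately have "((\<lambda>i. (norm (ell2_nth x i))\<^sup>2 + - ?f i) has_sum
      ((norm x)\<^sup>2 + - (\<Sum>i\<in>F. (norm (ell2_nth x i))\<^sup>2))) UNIV"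
    by (rule has_sum_add)
  moreover have "(\<lambda>i. (norm (ell2_nth x i))\<^sup>2 + - ?f i) = (\<lambda>i. (norm (ell2_nth (x - ?y) i))\<^sup>2)"
    by (rule ext) (simp add: minus_ell2.rep_eq y)
  ultimately show ?thesis
    by (simp add: ell2_norm_square[of "_ - _"] infsumI)
qed

text \<open>Finitely supported vectors are dense. By complex linearity the difference
  \<open>D\<close> kills them, so \<open>D x\<close> is bounded by \<open>norm D\<close> times the
  norm of an arbitrarily small tail of \<open>x\<close>. This makes the description operator in
  \<open>H_op\<close> meaningful.\<close>

lemma has_matrix_unique:
  assumes "has_matrix T m" "has_matrix U m"
  shows "T = U"
proof -
  define D where "D = T - U"
  have D: "blinfun_apply D (scaleC_ell2 z (basis_ell2 i)) = 0" for z i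
  proof -
    have "blinfun_apply T (basis_ell2 i) = blinfun_apply U (basis_ell2 i)"
      using assms by (intro ell2_eqI) (simp add: has_matrix_def)
    then show ?thesis
      using assms by (simp add: D_def has_matrix_def blinfun.diff_left)
  qed
  have "blinfun_apply D x = 0" for x
  proof -
    let ?p = "\<lambda>F. \<Sum>i\<in>F. (norm (ell2_nth x i))\<^sup>2"
    have le: "norm (blinfun_apply D x) \<le> norm D * sqrt ((norm x)\<^sup>2 - ?p F)" if "finite F" for F
    proof -
      let ?y = "\<Sum>i\<in>F. scaleC_ell2 (ell2_nth x i) (basis_ell2 i)"
      have "blinfun_apply D x = blinfun_apply D (x - ?y)"
        by (simp add: blinfun.diff_right blinfun.sum_right D)
      also have "norm \<dots> \<le> norm D * norm (x - ?y)"
        by (rule norm_blinfun)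
      also have "norm (x - ?y) = sqrt ((norm x)\<^sup>2 - ?p F)"
        by (simp flip: norm_ell2_diff_partial[OF that])
      finally show ?thesis .
    qed
    have "(?p \<longlongrightarrow> (norm x)\<^sup>2) (finite_subsets_at_top UNIV)"
      unfolding ell2_norm_square by (rule infsum_tendsto[OF ell2_nth_summable])
    then have "((\<lambda>F. norm D * sqrt ((norm x)\<^sup>2 - ?p F)) \<longlongrightarrow> norm D * sqrt ((norm x)\<^sup>2 - (norm x)\<^sup>2))
        (finite_subsets_at_top UNIV)"
      by (intro tendsto_intros)
    then have "norm (blinfun_apply D x) \<le> norm D * sqrt ((norm x)\<^sup>2 - (norm x)\<^sup>2)"
      by (rule tendsto_lowerbound) (auto intro!: eventually_finite_subsets_at_top_weakI le)
    then show ?thesis by simp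
  qed
  then have "D = 0" by (intro blinfun_eqI) simp
  then show ?thesis by (simp add: D_def)
qed

section \<open>Bounded operators from a kernel, its adjoint and their product\<close>

lemma scaleR_eq_scaleC_ell2: "r *\<^sub>R x = scaleC_ell2 (of_real r) x" for x :: "'a ell2"
  by (rule ell2_eqI) (simp add: scaleR_ell2.rep_eq scaleC_ell2.rep_eq scaleR_conv_of_real)

text \<open>Finite rows make the action of \<open>K\<close> a finite sum in each coordinate. The
  bound compares finite sums only, with \<open>G\<close> covering the supports of the chosen rows,
  so it can be checked without any convergence argument; \<open>c\<close> bounds the squared norm of
  \<open>K\<close>.\<close>

locale row_finite_kernel =
  fixes K :: "'a \<Rightarrow> 'b \<Rightarrow> real" and S :: "'a \<Rightarrow> 'b set" and c :: real
  assumes finite_row: "finite (S a)"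
    and kernel_eq_0: "b \<notin> S a \<Longrightarrow> K a b = 0"
    and c_nonneg: "0 \<le> c"
    and kernel_bound: "finite F \<Longrightarrow> finite G \<Longrightarrow> (\<Union>a\<in>F. S a) \<subseteq> G \<Longrightarrow>
      (\<Sum>a\<in>F. (norm (\<Sum>b\<in>S a. of_real (K a b) * y b))\<^sup>2) \<le> c * (\<Sum>b\<in>G. (norm (y b :: complex))\<^sup>2)"
begin

text \<open>\<open>Abs_ell2\<close> has the intended coefficients only for square-summable families;
  \<open>nth_kernel_apply\<close> and \<open>nth_adjoint_apply\<close> record that this is the case
  here.\<close>

definition kernel_apply :: "'b ell2 \<Rightarrow> 'a ell2" where
  "kernel_apply y = Abs_ell2 (\<lambda>a. \<Sum>b\<in>S a. of_real (K a b) * ell2_nth y b)"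

definition adjoint_apply :: "'a ell2 \<Rightarrow> 'b ell2" where
  "adjoint_apply x = Abs_ell2 (\<lambda>b. \<Sum>\<^sub>\<infinity>a. of_real (K a b) * ell2_nth x a)"

lemma kernel_apply_partial_bound:
  assumes "finite F"
  shows "(\<Sum>a\<in>F. (norm (\<Sum>b\<in>S a. of_real (K a b) * ell2_nth y b))\<^sup>2) \<le> c * (norm y)\<^sup>2"
proof -
  let ?G = "\<Union>a\<in>F. S a"
  have fin: "finite ?G" using assms finite_row by auto
  have "(\<Sum>a\<in>F. (norm (\<Sum>b\<in>S a. of_real (K a b) * ell2_nth y b))\<^sup>2)
      \<le> c * (\<Sum>b\<in>?G. (norm (ell2_nth y b))\<^sup>2)"
    using assms fin by (rule kernel_bound) simp
  also have "\<dots> \<le> c * (norm y)\<^sup>2"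
    unfolding ell2_norm_square
    by (intro mult_left_mono c_nonneg finite_sum_le_infsum ell2_nth_summable fin) auto
  finally show ?thesis .
qed

lemma kernel_apply_summable:
  "(\<lambda>a. (norm (\<Sum>b\<in>S a. of_real (K a b) * ell2_nth y b))\<^sup>2) summable_on UNIV"
  by (rule nonneg_bdd_above_summable_on) (auto intro!: bdd_aboveI2 kernel_apply_partial_bound)

lemma nth_kernel_apply: "ell2_nth (kernel_apply y) a = (\<Sum>b\<in>S a. of_real (K a b) * ell2_nth y b)"
  unfolding kernel_apply_def by (subst Abs_ell2_inverse) (use kernel_apply_summable in auto)

lemma norm_kernel_apply: "(norm (kernel_apply y))\<^sup>2 \<le> c * (norm y)\<^sup>2"
  unfolding ell2_norm_square[of "kernel_apply y"] nth_kernel_apply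
  by (rule infsum_le_finite_sums[OF kernel_apply_summable kernel_apply_partial_bound])

text \<open>The column with index \<open>b\<close> is the image of the basis vector at
  \<open>b\<close>.\<close>

lemma column_summable: "(\<lambda>a. (norm (complex_of_real (K a b)))\<^sup>2) summable_on UNIV"
proof -
  have "(\<Sum>b'\<in>S a. complex_of_real (K a b') * ell2_nth (basis_ell2 b) b') = of_real (K a b)" for a
    using finite_row[of a] kernel_eq_0[of b a]
    by (simp add: basis_ell2.rep_eq if_distrib[of "\<lambda>z. _ * z"] cong: if_cong)
  then show ?thesis using kernel_apply_summable[of "basis_ell2 b"] by simp
qed

lemma column_mult_summable: "(\<lambda>a. of_real (K a b) * ell2_nth x a) summable_on UNIV"
  by (rule square_summable_mult[OF column_summable ell2_nth_summable])

text \<open>Duality: the square sum of the coefficients of \<open>adjoint_apply x\<close> over a finite set is the inner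
  product of \<open>x\<close> with the image of the truncated coefficient vector.\<close>

lemma adjoint_apply_partial_bound:
  assumes "finite G"
  shows "(\<Sum>b\<in>G. (norm (\<Sum>\<^sub>\<infinity>a. of_real (K a b) * ell2_nth x a))\<^sup>2) \<le> c * (norm x)\<^sup>2"
proof -
  define z where "z b = (\<Sum>\<^sub>\<infinity>a. of_real (K a b) * ell2_nth x a)" for b
  define y where "y = (\<Sum>b\<in>G. scaleC_ell2 (z b) (basis_ell2 b))"
  define N where "N = (\<Sum>b\<in>G. (norm (z b))\<^sup>2)"
  have y: "ell2_nth y b = (if b \<in> G then z b else 0)" for b
    using assms by (simp add: y_def ell2_nth_sum scaleC_ell2.rep_eq basis_ell2.rep_eq
        if_distrib[of "\<lambda>z. _ * z"] cong: if_cong)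
  have "((\<lambda>b. (norm (ell2_nth y b))\<^sup>2) has_sum N) UNIV"
    using has_sum_finite_support[OF assms, of "\<lambda>b. (norm (ell2_nth y b))\<^sup>2"]
    by (simp add: N_def y)
  then have norm_y: "(norm y)\<^sup>2 = N"
    by (simp add: ell2_norm_square infsumI)
  have "((\<lambda>a. inner (z b) (of_real (K a b) * ell2_nth x a)) has_sum inner (z b) (z b)) UNIV" for b
    by (rule has_sum_bounded_linear[OF bounded_linear_inner_right])
      (simp add: z_def column_mult_summable)
  then have "((\<lambda>a. \<Sum>b\<in>G. inner (z b) (of_real (K a b) * ell2_nth x a)) has_sum (\<Sum>b\<in>G. inner (z b) (z b))) UNIV"
    by (rule has_sum_sum)
  moreover have "(\<Sum>b\<in>G. inner (z b) (of_real (K a b) * ell2_nth x a)) = inner (ell2_nth (kernel_apply y) a) (ell2_nth x a)" for a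
  proof -
    have "ell2_nth (kernel_apply y) a = (\<Sum>b\<in>G. of_real (K a b) * z b)"
      unfolding nth_kernel_apply y using finite_row[of a] kernel_eq_0[of _ a] assms
      by (intro sum.mono_neutral_cong) auto
    then show ?thesis
      by (simp add: inner_sum_left scaleR_conv_of_real[symmetric])
  qed
  ultimately have "N = inner (kernel_apply y) x"
    by (simp add: N_def inner_ell2_def infsumI power2_norm_eq_inner)
  also have "\<dots> \<le> norm (kernel_apply y) * norm x"
    by (rule norm_cauchy_schwarz)
  finally have "N\<^sup>2 \<le> (norm (kernel_apply y) * norm x)\<^sup>2"
    by (intro power_mono) (auto simp: N_def sum_nonneg)
  also have "\<dots> \<le> c * N * (norm x)\<^sup>2"
    unfolding power_mult_distrib norm_y[symmetric] by (intro mult_right_mono norm_kernel_apply) auto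
  finally have "N * N \<le> (c * (norm x)\<^sup>2) * N"
    by (simp add: power2_eq_square mult_ac)
  \<comment> \<open>Cancel one factor \<open>N\<close> if it is positive; otherwise the right-hand
    side is nonnegative anyway.\<close>
  then have "N \<le> c * (norm x)\<^sup>2"
    using c_nonneg by (cases "N > 0") (auto intro: order_trans[of _ 0])
  then show ?thesis
    by (simp add: N_def z_def)
qed

lemma adjoint_apply_summable:
  "(\<lambda>b. (norm (\<Sum>\<^sub>\<infinity>a. of_real (K a b) * ell2_nth x a))\<^sup>2) summable_on UNIV"
  by (rule nonneg_bdd_above_summable_on) (auto intro!: bdd_aboveI2 adjoint_apply_partial_bound)

lemma nth_adjoint_apply: "ell2_nth (adjoint_apply x) b = (\<Sum>\<^sub>\<infinity>a. of_real (K a b) * ell2_nth x a)"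
  unfolding adjoint_apply_def by (subst Abs_ell2_inverse) (use adjoint_apply_summable in auto)

lemma norm_adjoint_apply: "(norm (adjoint_apply x))\<^sup>2 \<le> c * (norm x)\<^sup>2"
  unfolding ell2_norm_square[of "adjoint_apply x"] nth_adjoint_apply
  by (rule infsum_le_finite_sums[OF adjoint_apply_summable adjoint_apply_partial_bound])

lemma gram_add: "kernel_apply (adjoint_apply (x + y)) = kernel_apply (adjoint_apply x) + kernel_apply (adjoint_apply y)"
  by (rule ell2_eqI)
    (simp add: nth_kernel_apply nth_adjoint_apply plus_ell2.rep_eq distrib_left
      infsum_add[OF column_mult_summable column_mult_summable] sum.distrib)

lemma gram_scaleC: "kernel_apply (adjoint_apply (scaleC_ell2 z x)) = scaleC_ell2 z (kernel_apply (adjoint_apply x))"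
  by (rule ell2_eqI)
    (simp add: nth_kernel_apply nth_adjoint_apply scaleC_ell2.rep_eq mult.left_commute[of _ z]
      infsum_cmult_right[OF column_mult_summable] sum_distrib_left)

text \<open>Each of the two factors contributes a factor \<open>c\<close> to the squared
  norm.\<close>

lemma norm_gram_apply: "norm (kernel_apply (adjoint_apply x)) \<le> c * norm x"
proof (rule power2_le_imp_le)
  have "(norm (kernel_apply (adjoint_apply x)))\<^sup>2 \<le> c * (c * (norm x)\<^sup>2)"
    by (rule order_trans[OF norm_kernel_apply]) (intro mult_left_mono norm_adjoint_apply c_nonneg)
  then show "(norm (kernel_apply (adjoint_apply x)))\<^sup>2 \<le> (c * norm x)\<^sup>2"
    by (simp add: power_mult_distrib power2_eq_square mult_ac)
qed (simp add: c_nonneg)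

lemma bounded_linear_gram: "bounded_linear (\<lambda>x. kernel_apply (adjoint_apply x))"
  by (rule bounded_linear_intro[where K = c])
    (simp_all add: gram_add scaleR_eq_scaleC_ell2 gram_scaleC
      norm_gram_apply[unfolded mult.commute[of c]])

definition gram :: "'a ell2 \<Rightarrow>\<^sub>L 'a ell2" where
  "gram = Blinfun (\<lambda>x. kernel_apply (adjoint_apply x))"

lemma gram_apply: "blinfun_apply gram x = kernel_apply (adjoint_apply x)"
  by (simp add: gram_def bounded_linear_Blinfun_apply[OF bounded_linear_gram])

lemma norm_gram: "norm gram \<le> c"
  by (rule norm_blinfun_bound) (simp_all add: gram_apply c_nonneg norm_gram_apply)

text \<open>The adjoint sends the basis vector at \<open>a'\<close> to row \<open>a'\<close> of
  \<open>K\<close>, so the entries are inner products of rows.\<close>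

lemma has_matrix_gram: "has_matrix gram (\<lambda>a a'. of_real (\<Sum>b\<in>S a. K a b * K a' b))"
proof -
  have "((\<lambda>a. complex_of_real (K a b) * ell2_nth (basis_ell2 a') a) has_sum of_real (K a' b)) UNIV" for a' b
    using has_sum_finite_support[of "{a'}" "\<lambda>a. complex_of_real (K a b) * ell2_nth (basis_ell2 a') a"]
    by (simp add: basis_ell2.rep_eq)
  then have "ell2_nth (adjoint_apply (basis_ell2 a')) b = of_real (K a' b)" for a' b
    by (simp add: nth_adjoint_apply infsumI)
  then show ?thesis
    by (simp add: has_matrix_def gram_apply gram_scaleC nth_kernel_apply)
qed

end

section \<open>The Pascal matrix\<close>

text \<open>Pascal's rule gives \<open>(1 - x) S (k + 1) \<le> x S k\<close> for the partial sums \<open>S k\<close>.\<close>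

lemma sum_choose_power_le:
  fixes x :: real
  assumes "0 \<le> x" "x < 1"
  shows "(\<Sum>n\<le>M. (n choose k) * x ^ n) \<le> x ^ k / (1 - x) ^ (k + 1)"
proof (induction k)
  case 0
  have "(\<Sum>n\<le>M. x ^ n) \<le> 1 / (1 - x)"
    using assms sum_gp_multiplied[of 0 M x] zero_le_power[OF assms(1), of "Suc M"]
    by (simp add: pos_le_divide_eq atMost_atLeast0 mult.commute)
  then show ?case by simp
next
  case (Suc k)
  let ?S = "\<lambda>k. \<Sum>n\<le>M. (n choose k) * x ^ n"
  have x: "0 < 1 - x" using assms by simp
  \<comment> \<open>The additional nonnegative term lets the index shift end at \<open>M\<close>
    again; the term at 0 vanishes because \<open>0 choose Suc k = 0\<close>.\<close>
  have "?S (Suc k) \<le> (\<Sum>n\<le>Suc M. (n choose Suc k) * x ^ n)"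
    using assms by simp
  also have "\<dots> = (\<Sum>n\<le>M. x * ((n choose k) * x ^ n) + x * ((n choose Suc k) * x ^ n))"
    by (subst sum.atMost_Suc_shift) (simp add: algebra_simps)
  also have "\<dots> = x * ?S k + x * ?S (Suc k)"
    by (simp add: sum.distrib sum_distrib_left)
  finally have "?S (Suc k) * (1 - x) \<le> x * ?S k"
    by (simp add: algebra_simps)
  also have "\<dots> \<le> x * (x ^ k / (1 - x) ^ (k + 1))"
    using Suc assms by (intro mult_left_mono) auto
  finally have "?S (Suc k) \<le> x * (x ^ k / (1 - x) ^ (k + 1)) / (1 - x)"
    by (rule pos_le_divide_eq[OF x, THEN iffD2])
  then show ?case by (simp add: mult_ac)
qed

text \<open>The bound on partial sums gives convergence, after which Pascal's rule for the full
  series is an exact recursion in \<open>k\<close>. The exact value serves the lower bound on the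
  norm.\<close>

lemma has_sum_choose_power:
  fixes x :: real
  assumes "0 \<le> x" "x < 1"
  shows "((\<lambda>n. (n choose k) * x ^ n) has_sum (x ^ k / (1 - x) ^ (k + 1))) UNIV"
proof -
  have summ: "summable (\<lambda>n. (n choose k) * x ^ n)" for k
  proof (rule bounded_imp_summable)
    show "(\<Sum>n\<le>M. (n choose k) * x ^ n) \<le> x ^ k / (1 - x) ^ (k + 1)" for M
      by (rule sum_choose_power_le[OF assms])
  qed (use assms in auto)
  have "(\<Sum>n. (n choose k) * x ^ n) = x ^ k / (1 - x) ^ (k + 1)"
  proof (induction k)
    case 0
    then show ?case using assms by (simp add: suminf_geometric)
  next
    case (Suc k)
    let ?S = "\<lambda>k. \<Sum>n. (n choose k) * x ^ n"
    have "?S (Suc k) = (\<Sum>n. (Suc n choose Suc k) * x ^ Suc n)"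
      using suminf_split_head[OF summ[of "Suc k"]] by simp
    also have "\<dots> = (\<Sum>n. x * ((n choose k) * x ^ n) + x * ((n choose Suc k) * x ^ n))"
      by (simp add: algebra_simps)
    also have "\<dots> = x * ?S k + x * ?S (Suc k)"
      by (subst suminf_add[symmetric]) (intro summable_mult summ, intro summable_mult summ, simp add: suminf_mult summ)
    finally have "?S (Suc k) = x * ?S k / (1 - x)"
      using assms by (simp add: field_simps)
    then show ?case
      unfolding Suc by (simp add: mult_ac)
  qed
  then show ?thesis
    using summ[of k] assms by (intro sums_nonneg_imp_has_sum) (auto simp: sums_iff)
qed

text \<open>Cauchy-Schwarz with the positive weights \<open>p\<close> free to choose: powers of
  \<open>u\<close> give Schur's test, the constant 1 gives the collision estimate for multinomial
  weights.\<close>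

lemma norm_sum_weighted_square_le:
  fixes y :: "'i \<Rightarrow> complex" and c p :: "'i \<Rightarrow> real"
  assumes "\<And>i. i \<in> A \<Longrightarrow> 0 \<le> c i" "\<And>i. i \<in> A \<Longrightarrow> 0 < p i"
  shows "(norm (\<Sum>i\<in>A. of_real (c i) * y i))\<^sup>2
    \<le> (\<Sum>i\<in>A. c i * p i) * (\<Sum>i\<in>A. c i * (norm (y i))\<^sup>2 / p i)"
proof -
  have "norm (\<Sum>i\<in>A. of_real (c i) * y i) \<le> (\<Sum>i\<in>A. c i * norm (y i))"
    by (rule sum_norm_le) (simp add: norm_mult assms(1))
  also have "\<dots> = (\<Sum>i\<in>A. sqrt (c i * p i) * (sqrt (c i / p i) * norm (y i)))"
  proof (rule sum.cong)
    fix i assume "i \<in> A"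
    then have "sqrt (c i * p i) * sqrt (c i / p i) = c i"
      using assms(1,2)[of i] by (simp add: real_sqrt_mult real_sqrt_divide)
    then show "c i * norm (y i) = sqrt (c i * p i) * (sqrt (c i / p i) * norm (y i))"
      by (simp flip: mult.assoc)
  qed simp
  finally have "(norm (\<Sum>i\<in>A. of_real (c i) * y i))\<^sup>2
      \<le> (\<Sum>i\<in>A. sqrt (c i * p i) * (sqrt (c i / p i) * norm (y i)))\<^sup>2"
    by (rule power_mono) simp
  also have "\<dots> \<le> (\<Sum>i\<in>A. (sqrt (c i * p i))\<^sup>2) * (\<Sum>i\<in>A. (sqrt (c i / p i) * norm (y i))\<^sup>2)"
    by (rule Cauchy_Schwarz_ineq_sum)
  also have "\<dots> = (\<Sum>i\<in>A. c i * p i) * (\<Sum>i\<in>A. c i * (norm (y i))\<^sup>2 / p i)"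
    using assms by (intro arg_cong2[where f = "(*)"] sum.cong refl)
      (auto simp: power_mult_distrib less_imp_le)
  finally show ?thesis .
qed

text \<open>Schur's test with row weights \<open>u ^ k\<close>, where \<open>u = x / (1 - x)\<close>; they are chosen such that
  the row sums are \<open>(1 + u) ^ m\<close> and \<open>s\<^sup>2 * (1 + u) = x\<close>.\<close>

lemma pascal_matrix_bound:
  fixes y :: "nat \<Rightarrow> complex" and s x :: real
  assumes x: "0 < x" "x < 1" and s: "s\<^sup>2 = x * (1 - x)"
  shows "(\<Sum>m\<le>M. s ^ (2 * m) * (norm (\<Sum>k\<le>m. of_real (m choose k) * y k))\<^sup>2)
    \<le> 1 / (1 - x) * (\<Sum>k\<le>M. (norm (y k))\<^sup>2)"
proof -
  define u where "u = x / (1 - x)"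
  have u: "u > 0" "s\<^sup>2 * (1 + u) = x"
    using x s by (auto simp: u_def field_simps)
  have row: "s ^ (2 * m) * (norm (\<Sum>k\<le>m. of_real (m choose k) * y k))\<^sup>2
      \<le> (\<Sum>k\<le>M. (norm (y k))\<^sup>2 / u ^ k * ((m choose k) * x ^ m))" (is "?l \<le> ?r") if "m \<le> M" for m
  proof -
    have "?l \<le> s ^ (2 * m) * ((\<Sum>k\<le>m. (m choose k) * u ^ k) * (\<Sum>k\<le>m. (m choose k) * (norm (y k))\<^sup>2 / u ^ k))"
      using norm_sum_weighted_square_le[of "{..m}" "\<lambda>k. real (m choose k)" "\<lambda>k. u ^ k" y] u(1)
      by (intro mult_left_mono) auto
    also have "(\<Sum>k\<le>m. (m choose k) * u ^ k) = (1 + u) ^ m"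
      using binomial_ring[of u 1 m] by (simp add: add.commute)
    also have "s ^ (2 * m) * ((1 + u) ^ m * (\<Sum>k\<le>m. (m choose k) * (norm (y k))\<^sup>2 / u ^ k))
        = x ^ m * (\<Sum>k\<le>m. (m choose k) * (norm (y k))\<^sup>2 / u ^ k)"
      unfolding u(2)[symmetric] by (simp add: power_mult power_mult_distrib)
    also have "\<dots> = (\<Sum>k\<le>m. (norm (y k))\<^sup>2 / u ^ k * ((m choose k) * x ^ m))"
      by (simp add: sum_distrib_left mult_ac)
    \<comment> \<open>The range grows to a common bound \<open>M\<close>, since
      \<open>m choose k\<close> vanishes for \<open>k > m\<close>.\<close>
    also have "\<dots> = ?r"
      using that by (intro sum.mono_neutral_left) auto
    finally show ?thesis .
  qed
  have "(\<Sum>m\<le>M. s ^ (2 * m) * (norm (\<Sum>k\<le>m. of_real (m choose k) * y k))\<^sup>2)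
      \<le> (\<Sum>m\<le>M. \<Sum>k\<le>M. (norm (y k))\<^sup>2 / u ^ k * ((m choose k) * x ^ m))"
    by (intro sum_mono row) auto
  also have "\<dots> = (\<Sum>k\<le>M. (norm (y k))\<^sup>2 / u ^ k * (\<Sum>m\<le>M. (m choose k) * x ^ m))"
    by (subst sum.swap) (simp add: sum_distrib_left)
  also have "\<dots> \<le> (\<Sum>k\<le>M. (norm (y k))\<^sup>2 / u ^ k * (x ^ k / (1 - x) ^ (k + 1)))"
    using x u by (intro sum_mono mult_left_mono sum_choose_power_le) auto
  \<comment> \<open>Since \<open>x ^ k / (1 - x) ^ (k + 1) = u ^ k / (1 - x)\<close>, the Schur
    weights cancel.\<close>
  also have "\<dots> = (\<Sum>k\<le>M. 1 / (1 - x) * (norm (y k))\<^sup>2)"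
    using x by (intro sum.cong refl) (simp add: u_def field_simps)
  finally show ?thesis
    by (simp add: sum_distrib_left)
qed

section \<open>Multinomial weights\<close>

definition multinomial_weight :: "('d::finite \<Rightarrow> real) \<Rightarrow> 'd multi \<Rightarrow> real" where
  "multinomial_weight r \<alpha> = fact (multi_size \<alpha>) / real (multi_fact \<alpha>) * (\<Prod>j\<in>UNIV. r j ^ \<alpha> j)"

lemma multi_fact_pos: "0 < multi_fact \<alpha>"
  by (simp add: multi_fact_def)

lemma finite_multi_size_le: "finite {\<alpha> :: 'd::finite multi. multi_size \<alpha> \<le> M}"
proof (rule finite_subset)
  have "\<alpha> j \<le> multi_size \<alpha>" for \<alpha> :: "'d multi" and j
    unfolding multi_size_def by (rule member_le_sum) auto
  then show "{\<alpha> :: 'd multi. multi_size \<alpha> \<le> M} \<subseteq> {\<alpha>. \<forall>j. (j \<in> UNIV \<longrightarrow> \<alpha> j \<in> {..M}) \<and> (j \<notin> UNIV \<longrightarrow> \<alpha> j = 0)}"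
    by (auto intro: order_trans)
  show "finite {\<alpha> :: 'd multi. \<forall>j. (j \<in> UNIV \<longrightarrow> \<alpha> j \<in> {..M}) \<and> (j \<notin> UNIV \<longrightarrow> \<alpha> j = 0)}"
    by (rule finite_set_of_finite_funs) auto
qed

lemma finite_multi_size_eq: "finite {\<alpha> :: 'd::finite multi. multi_size \<alpha> = m}"
  by (rule finite_subset[OF _ finite_multi_size_le[of m]]) auto

lemma multi_size_incr: "multi_size (\<beta>(j := Suc (\<beta> j))) = Suc (multi_size \<beta>)"
  by (simp add: multi_size_def sum.remove[of UNIV j])

lemma multinomial_weight_incr:
  "real (Suc (multi_size \<beta>)) * (r j * multinomial_weight r \<beta>)
    = real (Suc (\<beta> j)) * multinomial_weight r (\<beta>(j := Suc (\<beta> j)))"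
proof -
  have "real (multi_fact (\<beta>(j := Suc (\<beta> j)))) = real (Suc (\<beta> j)) * real (multi_fact \<beta>)"
    by (simp add: multi_fact_def prod.remove[of UNIV j] algebra_simps)
  moreover have "(\<Prod>i\<in>UNIV. r i ^ (\<beta>(j := Suc (\<beta> j))) i) = r j * (\<Prod>i\<in>UNIV. r i ^ \<beta> i)"
    by (simp add: prod.remove[of UNIV j])
  ultimately show ?thesis
    using multi_fact_pos[of \<beta>]
    by (simp add: multinomial_weight_def multi_size_incr field_simps del: of_nat_Suc)
qed

text \<open>Conditioning on the last trial: the summand for \<open>j\<close> is the fraction
  \<open>\<alpha> j / multi_size \<alpha>\<close> of the weight, and these fractions add up to 1.
  Restricting to \<open>\<alpha> j > 0\<close> keeps the truncated subtraction harmless.\<close>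

lemma multinomial_weight_rec:
  fixes \<alpha> :: "'d::finite multi"
  assumes "multi_size \<alpha> = Suc m"
  shows "multinomial_weight r \<alpha>
    = (\<Sum>j | \<alpha> j > 0. r j * multinomial_weight r (\<alpha>(j := \<alpha> j - 1)))"
proof -
  have "real (Suc m) * (r j * multinomial_weight r (\<alpha>(j := \<alpha> j - 1)))
      = real (\<alpha> j) * multinomial_weight r \<alpha>" if "\<alpha> j > 0" for j
  proof -
    define \<beta> where "\<beta> = \<alpha>(j := \<alpha> j - 1)"
    have \<alpha>: "\<beta>(j := Suc (\<beta> j)) = \<alpha>" and j: "Suc (\<beta> j) = \<alpha> j"
      using that by (auto simp: \<beta>_def)
    have "multi_size \<beta> = m"
      using multi_size_incr[of \<beta> j] assms by (simp add: \<alpha>)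
    then show ?thesis
      using multinomial_weight_incr[of \<beta> r j] unfolding \<alpha> unfolding j \<beta>_def[symmetric] by simp
  qed
  then have "real (Suc m) * (\<Sum>j | \<alpha> j > 0. r j * multinomial_weight r (\<alpha>(j := \<alpha> j - 1)))
      = (\<Sum>j | \<alpha> j > 0. real (\<alpha> j) * multinomial_weight r \<alpha>)"
    by (simp add: sum_distrib_left)
  also have "\<dots> = (\<Sum>j\<in>UNIV. real (\<alpha> j) * multinomial_weight r \<alpha>)"
    by (rule sum.mono_neutral_left) auto
  also have "\<dots> = real (Suc m) * multinomial_weight r \<alpha>"
    by (simp add: assms[symmetric] multi_size_def flip: sum_distrib_right)
  finally show ?thesis by simp
qed

text \<open>For each \<open>j\<close>, lowering entry \<open>j\<close> is a bijection from the
  indices of size \<open>Suc m\<close> with positive entry \<open>j\<close> onto those of size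
  \<open>m\<close>.\<close>

lemma sum_multi_size_Suc:
  fixes g :: "'d::finite \<Rightarrow> 'd multi \<Rightarrow> real"
  shows "(\<Sum>\<alpha> | multi_size \<alpha> = Suc m. \<Sum>j | \<alpha> j > 0. g j (\<alpha>(j := \<alpha> j - 1)))
    = (\<Sum>j\<in>UNIV. \<Sum>\<beta> | multi_size \<beta> = m. g j \<beta>)"
proof -
  have "(\<Sum>\<alpha> | multi_size \<alpha> = Suc m. \<Sum>j | \<alpha> j > 0. g j (\<alpha>(j := \<alpha> j - 1)))
      = (\<Sum>j\<in>UNIV. \<Sum>\<alpha> | multi_size \<alpha> = Suc m \<and> \<alpha> j > 0. g j (\<alpha>(j := \<alpha> j - 1)))"
    using sum.swap_restrict[of "{\<alpha>. multi_size \<alpha> = Suc m}" UNIV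
        "\<lambda>\<alpha> j. g j (\<alpha>(j := \<alpha> j - 1))" "\<lambda>\<alpha> j. \<alpha> j > 0"]
    by (simp add: finite_multi_size_eq)
  also have "\<dots> = (\<Sum>j\<in>UNIV. \<Sum>\<beta> | multi_size \<beta> = m. g j \<beta>)"
  proof (rule sum.cong)
    fix j
    have dec: "multi_size (\<alpha>(j := \<alpha> j - Suc 0)) = m" if "multi_size \<alpha> = Suc m" "\<alpha> j > 0" for \<alpha> :: "'d multi"
      using that multi_size_incr[of "\<alpha>(j := \<alpha> j - Suc 0)" j] by simp
    show "(\<Sum>\<alpha> | multi_size \<alpha> = Suc m \<and> \<alpha> j > 0. g j (\<alpha>(j := \<alpha> j - 1))) = (\<Sum>\<beta> | multi_size \<beta> = m. g j \<beta>)"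
      by (rule sum.reindex_bij_witness[where i = "\<lambda>\<beta>. \<beta>(j := Suc (\<beta> j))" and j = "\<lambda>\<alpha>. \<alpha>(j := \<alpha> j - 1)"])
        (auto simp: multi_size_incr dec)
  qed simp
  finally show ?thesis .
qed

text \<open>Monotonicity of the collision probability, without normalising \<open>r\<close>: apply
  Cauchy-Schwarz with weights \<open>r j\<close> to the recursion, then exchange the
  summations.\<close>

lemma sum_multinomial_weight_square_Suc_le:
  fixes r :: "'d::finite \<Rightarrow> real"
  assumes "\<And>j. 0 \<le> r j"
  shows "(\<Sum>\<alpha> | multi_size \<alpha> = Suc m. (multinomial_weight r \<alpha>)\<^sup>2)
    \<le> (\<Sum>j\<in>UNIV. r j)\<^sup>2 * (\<Sum>\<beta> | multi_size \<beta> = m. (multinomial_weight r \<beta>)\<^sup>2)"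
proof -
  let ?w = "multinomial_weight r" and ?s = "\<Sum>j\<in>UNIV. r j"
  have "(?w \<alpha>)\<^sup>2 \<le> ?s * (\<Sum>j | \<alpha> j > 0. r j * (?w (\<alpha>(j := \<alpha> j - 1)))\<^sup>2)"
    if "multi_size \<alpha> = Suc m" for \<alpha> :: "'d multi"
  proof -
    let ?J = "{j. \<alpha> j > 0}"
    have "(?w \<alpha>)\<^sup>2 = (norm (\<Sum>j\<in>?J. of_real (r j) * complex_of_real (?w (\<alpha>(j := \<alpha> j - 1)))))\<^sup>2"
      unfolding of_real_mult[symmetric] of_real_sum[symmetric] norm_of_real
      by (simp add: multinomial_weight_rec[OF that, of r])
    also have "\<dots> \<le> (\<Sum>j\<in>?J. r j) * (\<Sum>j\<in>?J. r j * (?w (\<alpha>(j := \<alpha> j - 1)))\<^sup>2)"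
      using norm_sum_weighted_square_le[of ?J r "\<lambda>_. 1" "\<lambda>j. of_real (?w (\<alpha>(j := \<alpha> j - 1)))"] assms by simp
    also have "\<dots> \<le> ?s * (\<Sum>j\<in>?J. r j * (?w (\<alpha>(j := \<alpha> j - 1)))\<^sup>2)"
      using assms by (intro mult_right_mono sum_mono2 sum_nonneg) auto
    finally show ?thesis .
  qed
  then have "(\<Sum>\<alpha> | multi_size \<alpha> = Suc m. (?w \<alpha>)\<^sup>2)
      \<le> ?s * (\<Sum>\<alpha> | multi_size \<alpha> = Suc m. \<Sum>j | \<alpha> j > 0. r j * (?w (\<alpha>(j := \<alpha> j - 1)))\<^sup>2)"
    unfolding sum_distrib_left[of ?s] by (intro sum_mono) auto
  also have "\<dots> = ?s * (?s * (\<Sum>\<beta> | multi_size \<beta> = m. (?w \<beta>)\<^sup>2))"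
    unfolding sum_multi_size_Suc[of "\<lambda>j \<beta>. r j * (?w \<beta>)\<^sup>2"] by (simp only: sum_product)
  finally show ?thesis
    by (simp add: power2_eq_square mult.assoc)
qed

lemma multi_size_0: "{\<alpha> :: 'd::finite multi. multi_size \<alpha> = 0} = {\<lambda>_. 0}"
  by (auto simp: multi_size_def fun_eq_iff)

lemma sum_multinomial_weight_square_1:
  fixes r :: "'d::finite \<Rightarrow> real"
  shows "(\<Sum>\<alpha> | multi_size \<alpha> = 1. (multinomial_weight r \<alpha>)\<^sup>2) = (\<Sum>j\<in>UNIV. (r j)\<^sup>2)"
proof -
  define e :: "'d \<Rightarrow> 'd multi" where "e j = (\<lambda>_. 0)(j := 1)" for j
  have "{\<alpha>. multi_size \<alpha> = 1} = range e"
  proof (intro equalityI subsetI)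
    fix \<alpha> :: "'d multi" assume "\<alpha> \<in> {\<alpha>. multi_size \<alpha> = 1}"
    then obtain j where "\<alpha> j = 1" "\<forall>i. j \<noteq> i \<longrightarrow> \<alpha> i = 0"
      using sum_eq_1_iff[of UNIV \<alpha>] by (auto simp: multi_size_def)
    then have "\<alpha> = e j" by (auto simp: e_def fun_eq_iff)
    then show "\<alpha> \<in> range e" by simp
  qed (auto simp: e_def multi_size_def sum.remove[of UNIV])
  moreover have "inj e"
    by (rule injI) (metis e_def fun_upd_apply zero_neq_one)
  moreover have "multinomial_weight r (e j) = r j" for j
    by (simp add: multinomial_weight_def e_def multi_size_def multi_fact_def
        sum.remove[of UNIV j] prod.remove[of UNIV j])
  ultimately show ?thesis
    by (simp add: sum.reindex)
qed

text \<open>The induction starts at size 1, where the sum of squares is exact; starting at size 0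
  would lose the factor that becomes \<open>Q\<close>.\<close>

lemma sum_multinomial_weight_square_le:
  fixes r :: "'d::finite \<Rightarrow> real"
  assumes "\<And>j. 0 \<le> r j"
  shows "(\<Sum>\<alpha> | multi_size \<alpha> = Suc m. (multinomial_weight r \<alpha>)\<^sup>2)
    \<le> (\<Sum>j\<in>UNIV. (r j)\<^sup>2) * (\<Sum>j\<in>UNIV. r j) ^ (2 * m)"
proof (induction m)
  case 0
  then show ?case using sum_multinomial_weight_square_1[of r] by simp
next
  case (Suc m)
  have "(\<Sum>\<alpha> | multi_size \<alpha> = Suc (Suc m). (multinomial_weight r \<alpha>)\<^sup>2)
      \<le> (\<Sum>j\<in>UNIV. r j)\<^sup>2 * (\<Sum>\<alpha> | multi_size \<alpha> = Suc m. (multinomial_weight r \<alpha>)\<^sup>2)"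
    by (rule sum_multinomial_weight_square_Suc_le[OF assms])
  also have "\<dots> \<le> (\<Sum>j\<in>UNIV. r j)\<^sup>2 * ((\<Sum>j\<in>UNIV. (r j)\<^sup>2) * (\<Sum>j\<in>UNIV. r j) ^ (2 * m))"
    by (intro mult_left_mono Suc) auto
  finally show ?case
    by (simp add: power2_eq_square mult_ac)
qed

section \<open>The factor of the matrix and its norm bound\<close>

text \<open>The columns are indexed by natural numbers in every dimension, so the norm estimate
  reduces to the one-dimensional Pascal matrix.\<close>

definition pascal_kernel :: "('d::finite \<Rightarrow> real) \<Rightarrow> 'd multi \<Rightarrow> nat \<Rightarrow> real" where
  "pascal_kernel r \<alpha> k = (-1) ^ multi_size \<alpha> * multinomial_weight r \<alpha> * (multi_size \<alpha> choose k)"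

text \<open>Rows of equal size differ only by a scalar, so grouping by size leaves the Pascal matrix
  with weights at most \<open>q * s ^ (2 * m)\<close>, except at size 0.\<close>

lemma pascal_kernel_partial_bound:
  fixes r :: "'d::finite \<Rightarrow> real" and y :: "nat \<Rightarrow> complex"
  assumes r: "\<And>j. 0 \<le> r j" and x: "0 < x" "x < 1" and sum_square: "(\<Sum>j\<in>UNIV. r j)\<^sup>2 = x * (1 - x)"
    and q: "(\<Sum>j\<in>UNIV. (r j)\<^sup>2) = q * (\<Sum>j\<in>UNIV. r j)\<^sup>2" "0 \<le> q" "q \<le> 1"
  shows "(\<Sum>\<alpha> | multi_size \<alpha> \<le> M. (norm (\<Sum>k\<le>multi_size \<alpha>. of_real (pascal_kernel r \<alpha> k) * y k))\<^sup>2)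
    \<le> (q / (1 - x) + (1 - q)) * (\<Sum>k\<le>M. (norm (y k))\<^sup>2)"
proof -
  let ?w = "multinomial_weight r"
  define s where "s = (\<Sum>j\<in>UNIV. r j)"
  define b where "b m = (norm (\<Sum>k\<le>m. of_real (m choose k) * y k))\<^sup>2" for m
  have b: "0 \<le> b m" for m by (simp add: b_def)
  have "(norm (\<Sum>k\<le>multi_size \<alpha>. of_real (pascal_kernel r \<alpha> k) * y k))\<^sup>2 = (?w \<alpha>)\<^sup>2 * b (multi_size \<alpha>)"
    for \<alpha>
  proof -
    have "(\<Sum>k\<le>multi_size \<alpha>. of_real (pascal_kernel r \<alpha> k) * y k)
        = of_real ((-1) ^ multi_size \<alpha> * ?w \<alpha>) * (\<Sum>k\<le>multi_size \<alpha>. of_real (multi_size \<alpha> choose k) * y k)"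
      by (simp add: pascal_kernel_def sum_distrib_left mult_ac)
    then show ?thesis
      by (simp add: b_def norm_mult norm_power power_mult_distrib)
  qed
  then have "(\<Sum>\<alpha> | multi_size \<alpha> \<le> M. (norm (\<Sum>k\<le>multi_size \<alpha>. of_real (pascal_kernel r \<alpha> k) * y k))\<^sup>2)
      = (\<Sum>\<alpha> | multi_size \<alpha> \<le> M. (?w \<alpha>)\<^sup>2 * b (multi_size \<alpha>))"
    by simp
  also have "\<dots> = (\<Sum>m\<le>M. \<Sum>\<alpha> | multi_size \<alpha> \<le> M \<and> multi_size \<alpha> = m. (?w \<alpha>)\<^sup>2 * b (multi_size \<alpha>))"
    using sum.group[of "{\<alpha>. multi_size \<alpha> \<le> M}" "{..M}" multi_size "\<lambda>\<alpha>. (?w \<alpha>)\<^sup>2 * b (multi_size \<alpha>)"]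
      finite_multi_size_le by (force simp: conj_commute)
  also have "\<dots> = (\<Sum>m\<le>M. b m * (\<Sum>\<alpha> | multi_size \<alpha> = m. (?w \<alpha>)\<^sup>2))"
    unfolding sum_distrib_left by (intro sum.cong) auto
  \<comment> \<open>At size 0 the weight is 1, split as \<open>q + (1 - q)\<close>; the excess
    \<open>1 - q\<close> meets only the coordinate \<open>y 0\<close>.\<close>
  also have "\<dots> \<le> (\<Sum>m\<le>M. q * (s ^ (2 * m) * b m) + (if m = 0 then (1 - q) * b 0 else 0))"
  proof (rule sum_mono)
    fix m
    have "b m * (\<Sum>\<alpha> | multi_size \<alpha> = m. (?w \<alpha>)\<^sup>2) \<le> b m * (q * s ^ (2 * m))" if "m > 0"
    proof -
      obtain m' where "m = Suc m'" using \<open>m > 0\<close> gr0_conv_Suc by blast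
      then have "(\<Sum>\<alpha> | multi_size \<alpha> = m. (?w \<alpha>)\<^sup>2) \<le> q * s ^ (2 * m)"
        using sum_multinomial_weight_square_le[where r = r and m = m', OF r] q(1)
        by (simp add: s_def power2_eq_square mult_ac)
      then show ?thesis by (rule mult_left_mono) (rule b)
    qed
    moreover have "(\<Sum>\<alpha> | multi_size \<alpha> = 0. (?w \<alpha>)\<^sup>2) = 1"
      by (simp add: multi_size_0) (simp add: multinomial_weight_def multi_size_def multi_fact_def)
    ultimately show "b m * (\<Sum>\<alpha> | multi_size \<alpha> = m. (?w \<alpha>)\<^sup>2)
        \<le> q * (s ^ (2 * m) * b m) + (if m = 0 then (1 - q) * b 0 else 0)"
      by (cases "m = 0") (auto simp: algebra_simps)
  qed
  also have "\<dots> = q * (\<Sum>m\<le>M. s ^ (2 * m) * b m) + (1 - q) * (norm (y 0))\<^sup>2"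
    by (simp add: sum.distrib sum_distrib_left b_def)
  also have "\<dots> \<le> q * (1 / (1 - x) * (\<Sum>k\<le>M. (norm (y k))\<^sup>2)) + (1 - q) * (\<Sum>k\<le>M. (norm (y k))\<^sup>2)"
    unfolding b_def using q x sum_square
    by (intro add_mono mult_left_mono pascal_matrix_bound member_le_sum[of 0 "{..M}" "\<lambda>k. (norm (y k))\<^sup>2"])
      (auto simp: s_def)
  finally show ?thesis
    by (simp add: algebra_simps)
qed

text \<open>Enlarge \<open>F\<close> to all rows of size at most the maximum \<open>M\<close>. This
  maximum is attained in \<open>F\<close>, so \<open>G\<close> contains
  \<open>{..M}\<close>.\<close>

lemma row_finite_pascal_kernel:
  fixes r :: "'d::finite \<Rightarrow> real"
  assumes "\<And>j. 0 \<le> r j" "0 < x" "x < 1" "(\<Sum>j\<in>UNIV. r j)\<^sup>2 = x * (1 - x)"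
    "(\<Sum>j\<in>UNIV. (r j)\<^sup>2) = q * (\<Sum>j\<in>UNIV. r j)\<^sup>2" "0 \<le> q" "q \<le> 1"
  shows "row_finite_kernel (pascal_kernel r) (\<lambda>\<alpha>. {..multi_size \<alpha>}) (q / (1 - x) + (1 - q))"
proof
  fix F :: "'d multi set" and G :: "nat set" and y :: "nat \<Rightarrow> complex"
  assume F: "finite F" and G: "finite G" and sub: "(\<Union>\<alpha>\<in>F. {..multi_size \<alpha>}) \<subseteq> G"
  let ?c = "q / (1 - x) + (1 - q)"
  show "(\<Sum>\<alpha>\<in>F. (norm (\<Sum>k\<le>multi_size \<alpha>. of_real (pascal_kernel r \<alpha> k) * y k))\<^sup>2)
      \<le> ?c * (\<Sum>k\<in>G. (norm (y k))\<^sup>2)"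
  proof (cases "F = {}")
    case False
    define M where "M = Max (multi_size ` F)"
    have M: "M \<in> multi_size ` F" "\<And>\<alpha>. \<alpha> \<in> F \<Longrightarrow> multi_size \<alpha> \<le> M"
      using F False by (auto simp: M_def)
    have "(\<Sum>\<alpha>\<in>F. (norm (\<Sum>k\<le>multi_size \<alpha>. of_real (pascal_kernel r \<alpha> k) * y k))\<^sup>2)
        \<le> (\<Sum>\<alpha> | multi_size \<alpha> \<le> M. (norm (\<Sum>k\<le>multi_size \<alpha>. of_real (pascal_kernel r \<alpha> k) * y k))\<^sup>2)"
      using M(2) by (intro sum_mono2 finite_multi_size_le) auto
    also have "\<dots> \<le> ?c * (\<Sum>k\<le>M. (norm (y k))\<^sup>2)"
      by (rule pascal_kernel_partial_bound[OF assms])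
    also have "\<dots> \<le> ?c * (\<Sum>k\<in>G. (norm (y k))\<^sup>2)"
      using M(1) sub G assms by (intro mult_left_mono sum_mono2) auto
    finally show ?thesis .
  qed (use assms in \<open>auto intro!: mult_nonneg_nonneg sum_nonneg\<close>)
qed (use assms in \<open>auto simp: pascal_kernel_def\<close>)

lemma sum_choose_mult_choose: "(\<Sum>k\<le>m. (m choose k) * (n choose k)) = (m + n) choose m"
proof -
  have "(\<Sum>k\<le>m. (m choose k) * (n choose k)) = (\<Sum>k\<le>m. (n choose k) * (m choose (m - k)))"
    by (intro sum.cong) (auto simp: binomial_symmetric[symmetric])
  then show ?thesis by (simp add: vandermonde add.commute)
qed

text \<open>Vandermonde's identity evaluates the sum over \<open>k\<close> as a binomial
  coefficient, whose denominator cancels the factorials of the sizes in the two weights.\<close>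

lemma pascal_kernel_gram:
  "(\<Sum>k\<le>multi_size \<alpha>. pascal_kernel (\<lambda>j. \<rho> $ j / 2) \<alpha> k * pascal_kernel (\<lambda>j. \<rho> $ j / 2) \<beta> k)
    = H_entry \<rho> \<alpha> \<beta>"
proof -
  let ?m = "multi_size \<alpha>" and ?n = "multi_size \<beta>" and ?w = "multinomial_weight (\<lambda>j. \<rho> $ j / 2)"
  have "(\<Sum>k\<le>?m. pascal_kernel (\<lambda>j. \<rho> $ j / 2) \<alpha> k * pascal_kernel (\<lambda>j. \<rho> $ j / 2) \<beta> k)
      = (-1) ^ (?m + ?n) * ?w \<alpha> * ?w \<beta> * real (\<Sum>k\<le>?m. (?m choose k) * (?n choose k))"
    by (simp add: pascal_kernel_def sum_distrib_left power_add mult_ac)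
  also have "real (\<Sum>k\<le>?m. (?m choose k) * (?n choose k)) = fact (?m + ?n) / (fact ?m * fact ?n)"
    unfolding sum_choose_mult_choose by (simp add: binomial_fact)
  finally show ?thesis
    by (simp add: H_entry_def multinomial_weight_def power_add prod.distrib)
qed

section \<open>The norm of the operator\<close>

lemma has_sum_range:
  assumes "inj g" "\<And>a. a \<notin> range g \<Longrightarrow> f a = 0" "((\<lambda>n. f (g n)) has_sum S) UNIV"
  shows "(f has_sum S) UNIV"
proof -
  have "(f has_sum S) (range g)"
    using has_sum_reindex[OF assms(1), of f S] assms(3) by (simp add: comp_def)
  then show ?thesis
    using has_sum_cong_neutral[of UNIV "range g" f f S] assms(2) by auto
qed

lemma has_sum_geometric:
  fixes x :: real
  assumes "0 \<le> x" "x < 1"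
  shows "((\<lambda>n. x ^ n) has_sum 1 / (1 - x)) UNIV"
  using has_sum_choose_power[OF assms, of 0] by simp

lemma H_op_eqI: "has_matrix T (\<lambda>\<alpha> \<beta>. complex_of_real (H_entry \<rho> \<alpha> \<beta>)) \<Longrightarrow> H_op \<rho> = T"
  unfolding H_op_def by (rule the_equality) (auto intro: has_matrix_unique)

text \<open>Rayleigh quotient of the geometric vector \<open>(-\<tau>) ^ n\<close> placed on the multiples of the \<open>j\<close>-th
  unit multi-index.\<close>

lemma gram_geometric_le:
  fixes r :: "'d::finite \<Rightarrow> real"
  assumes K: "row_finite_kernel (pascal_kernel r) (\<lambda>\<alpha>. {..multi_size \<alpha>}) c"
    and r: "\<And>i. 0 \<le> r i" "r j \<le> 1 / 2" and \<tau>: "0 \<le> \<tau>" "\<tau> < 1"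
  shows "1 - \<tau>\<^sup>2
    \<le> norm (row_finite_kernel.gram (pascal_kernel r) (\<lambda>\<alpha>. {..multi_size \<alpha>})) * (1 - 2 * r j * \<tau>)"
proof -
  interpret row_finite_kernel "pascal_kernel r" "\<lambda>\<alpha>. {..multi_size \<alpha>}" c by (rule K)
  define s where "s = r j"
  define g :: "nat \<Rightarrow> 'd multi" where "g n = (\<lambda>_. 0)(j := n)" for n
  \<comment> \<open>The alternating sign cancels the one in the kernel, so all terms below are
    nonnegative.\<close>
  define f where "f \<alpha> = (if \<alpha> \<in> range g then complex_of_real ((-\<tau>) ^ \<alpha> j) else 0)" for \<alpha>
  have inj: "inj g" by (rule injI) (metis g_def fun_upd_same)
  have gj: "g n j = n" for n by (simp add: g_def)
  have f_g: "f (g n) = complex_of_real ((-\<tau>) ^ n)" for n by (simp add: f_def gj)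
  have f_0: "f \<alpha> = 0" if "\<alpha> \<notin> range g" for \<alpha> using that by (simp add: f_def)
  have size_g: "multi_size (g n) = n" for n
    by (simp add: multi_size_def g_def sum.remove[of UNIV j])
  have w_g: "multinomial_weight r (g n) = s ^ n" for n
    by (simp add: multinomial_weight_def size_g)
      (simp add: multi_fact_def g_def s_def prod.remove[of UNIV j])
  have K_g: "pascal_kernel r (g n) k = (- s) ^ n * (n choose k)" for n k
    by (simp add: pascal_kernel_def size_g w_g power_minus[of s])
  have s\<tau>: "0 \<le> s * \<tau>" "s * \<tau> < 1 / 2"
  proof -
    show "0 \<le> s * \<tau>" using r \<tau> by (simp add: s_def)
    have "s * \<tau> \<le> 1 / 2 * \<tau>" using r \<tau> by (intro mult_right_mono) (auto simp: s_def)
    with \<tau> show "s * \<tau> < 1 / 2" by simp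
  qed
  have \<tau>2: "\<tau>\<^sup>2 < 1" using \<tau> by (simp add: power_less_one_iff abs_square_less_1)
  \<comment> \<open>The adjoint turns the geometric vector into another one, of ratio
    \<open>v\<close>; \<open>s * \<tau> < 1 / 2\<close> is what makes \<open>v < 1\<close>.\<close>
  define v where "v = s * \<tau> / (1 - s * \<tau>)"
  have v: "0 \<le> v" "v < 1" "1 + v = 1 / (1 - s * \<tau>)"
    using s\<tau> by (auto simp: v_def field_simps)
  have norm_f: "((\<lambda>\<alpha>. (norm (f \<alpha>))\<^sup>2) has_sum 1 / (1 - \<tau>\<^sup>2)) UNIV"
  proof (rule has_sum_range[OF inj])
    have "(\<lambda>n. (norm (f (g n)))\<^sup>2) = (\<lambda>n. (\<tau>\<^sup>2) ^ n)"
      using \<tau> by (simp add: f_g norm_power power_mult[symmetric] mult.commute)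
    then show "((\<lambda>n. (norm (f (g n)))\<^sup>2) has_sum 1 / (1 - \<tau>\<^sup>2)) UNIV"
      using has_sum_geometric[of "\<tau>\<^sup>2"] \<tau>2 by simp
  qed (simp add: f_0)
  define x where "x = Abs_ell2 f"
  have x: "ell2_nth x = f"
    unfolding x_def by (rule Abs_ell2_inverse) (use norm_f in \<open>auto simp: summable_on_def\<close>)
  have norm_x: "(norm x)\<^sup>2 = 1 / (1 - \<tau>\<^sup>2)"
    unfolding ell2_norm_square x by (rule infsumI[OF norm_f])
  have adj: "ell2_nth (adjoint_apply x) k = of_real (v ^ k / (1 - s * \<tau>))" for k
  proof -
    have "((\<lambda>\<alpha>. of_real (pascal_kernel r \<alpha> k) * f \<alpha>) has_sum
        complex_of_real ((s * \<tau>) ^ k / (1 - s * \<tau>) ^ (k + 1))) UNIV"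
    proof (rule has_sum_range[OF inj])
      have "((\<lambda>n. complex_of_real ((n choose k) * (s * \<tau>) ^ n)) has_sum
          complex_of_real ((s * \<tau>) ^ k / (1 - s * \<tau>) ^ (k + 1))) UNIV"
        using s\<tau> by (intro has_sum_of_real has_sum_choose_power) auto
      moreover have "complex_of_real ((n choose k) * (s * \<tau>) ^ n)
          = of_real (pascal_kernel r (g n) k) * f (g n)" for n
        unfolding K_g f_g of_real_mult[symmetric]
        by (simp add: power_mult_distrib power_minus[of s] power_minus[of \<tau>] flip: power_add)
      ultimately show "((\<lambda>n. of_real (pascal_kernel r (g n) k) * f (g n)) has_sum
          complex_of_real ((s * \<tau>) ^ k / (1 - s * \<tau>) ^ (k + 1))) UNIV"
        by simp
    qed (simp add: f_0)
    then show ?thesis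
      by (simp add: nth_adjoint_apply x infsumI v_def power_divide)
  qed
  \<comment> \<open>Coordinates on the range of \<open>g\<close> suffice, because \<open>x\<close>
    vanishes elsewhere.\<close>
  have T: "ell2_nth (blinfun_apply gram x) (g m) = of_real ((- s) ^ m * (1 + v) ^ Suc m)" for m
  proof -
    have "ell2_nth (blinfun_apply gram x) (g m)
        = of_real ((- s) ^ m / (1 - s * \<tau>) * (\<Sum>k\<le>m. (m choose k) * v ^ k))"
      unfolding gram_apply nth_kernel_apply size_g adj K_g
      by (simp add: sum_distrib_left sum_divide_distrib mult_ac)
    also have "(\<Sum>k\<le>m. (m choose k) * v ^ k) = (1 + v) ^ m"
      using binomial_ring[of v 1 m] by (simp add: add.commute)
    finally show ?thesis
      by (simp add: v(3))
  qed
  have "((\<lambda>\<alpha>. inner (ell2_nth x \<alpha>) (ell2_nth (blinfun_apply gram x) \<alpha>)) has_sum (1 + v) * (1 / (1 - v))) UNIV"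
  proof (rule has_sum_range[OF inj])
    \<comment> \<open>This fixed-point relation makes the terms of the inner product geometric with
      ratio \<open>v\<close>.\<close>
    have "v = s * \<tau> * (1 + v)"
      unfolding v(3) by (simp add: v_def)
    then have "inner (ell2_nth x (g m)) (ell2_nth (blinfun_apply gram x) (g m)) = (1 + v) * v ^ m" for m
    proof -
      have "inner (ell2_nth x (g m)) (ell2_nth (blinfun_apply gram x) (g m))
          = (-\<tau>) ^ m * ((- s) ^ m * (1 + v) ^ Suc m)"
        unfolding T x f_g by (simp add: inner_complex_def)
      also have "\<dots> = (1 + v) * (s * \<tau> * (1 + v)) ^ m"
        by (simp add: power_mult_distrib power_minus[of s] power_minus[of \<tau>] flip: power_add)
      finally show ?thesis
        using \<open>v = s * \<tau> * (1 + v)\<close> by simp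
    qed
    then show "((\<lambda>m. inner (ell2_nth x (g m)) (ell2_nth (blinfun_apply gram x) (g m))) has_sum (1 + v) * (1 / (1 - v))) UNIV"
      using has_sum_cmult_right[OF has_sum_geometric[OF v(1,2)], of "1 + v"] by simp
  qed (simp add: x f_0)
  then have "(1 + v) / (1 - v) = inner x (blinfun_apply gram x)"
    by (simp add: inner_ell2_def infsumI)
  also have "\<dots> \<le> norm x * norm (blinfun_apply gram x)"
    by (rule norm_cauchy_schwarz)
  also have "\<dots> \<le> norm x * (norm gram * norm x)"
    by (intro mult_left_mono norm_blinfun) simp
  also have "\<dots> = norm gram * (1 / (1 - \<tau>\<^sup>2))"
    unfolding norm_x[symmetric] by (simp add: power2_eq_square)
  also have "(1 + v) / (1 - v) = 1 / (1 - 2 * s * \<tau>)"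
    using s\<tau> by (simp add: v_def field_simps)
  finally show ?thesis
    using \<tau>2 s\<tau> by (simp add: field_simps s_def)
qed

text \<open>The difference of the two sides is a sum of nonnegative cross terms, which vanishes
  exactly when no two distinct entries are nonzero.\<close>

lemma sum_squares_le_square_sum:
  fixes a :: "'i \<Rightarrow> real"
  assumes "finite A" "\<And>i. i \<in> A \<Longrightarrow> 0 \<le> a i"
  shows "(\<Sum>i\<in>A. (a i)\<^sup>2) \<le> (\<Sum>i\<in>A. a i)\<^sup>2"
    and "(\<Sum>i\<in>A. (a i)\<^sup>2) = (\<Sum>i\<in>A. a i)\<^sup>2 \<longleftrightarrow> card {i\<in>A. a i \<noteq> 0} \<le> 1"
proof -
  let ?s = "\<Sum>i\<in>A. a i"
  have eq: "?s\<^sup>2 - (\<Sum>i\<in>A. (a i)\<^sup>2) = (\<Sum>i\<in>A. a i * (\<Sum>k\<in>A - {i}. a k))"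
    unfolding power2_eq_square sum_distrib_right[of a A ?s] sum_subtractf[symmetric]
    using assms(1) by (intro sum.cong) (auto simp: sum_diff1 algebra_simps)
  have nonneg: "0 \<le> a i * (\<Sum>k\<in>A - {i}. a k)" if "i \<in> A" for i
    using assms that by (intro mult_nonneg_nonneg sum_nonneg) auto
  have "0 \<le> (\<Sum>i\<in>A. a i * (\<Sum>k\<in>A - {i}. a k))"
    by (rule sum_nonneg) (rule nonneg)
  with eq show "(\<Sum>i\<in>A. (a i)\<^sup>2) \<le> ?s\<^sup>2"
    by simp
  have "(\<Sum>i\<in>A. (a i)\<^sup>2) = ?s\<^sup>2 \<longleftrightarrow> (\<forall>i\<in>A. a i * (\<Sum>k\<in>A - {i}. a k) = 0)"
    using eq sum_nonneg_eq_0_iff[OF assms(1) nonneg] by auto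
  also have "\<dots> \<longleftrightarrow> (\<forall>i\<in>A. a i \<noteq> 0 \<longrightarrow> (\<forall>k\<in>A - {i}. a k = 0))"
  proof (intro ball_cong refl)
    fix i
    have "(\<Sum>k\<in>A - {i}. a k) = 0 \<longleftrightarrow> (\<forall>k\<in>A - {i}. a k = 0)"
      using assms by (intro sum_nonneg_eq_0_iff) auto
    then show "a i * (\<Sum>k\<in>A - {i}. a k) = 0 \<longleftrightarrow> (a i \<noteq> 0 \<longrightarrow> (\<forall>k\<in>A - {i}. a k = 0))"
      by auto
  qed
  also have "\<dots> \<longleftrightarrow> card {i\<in>A. a i \<noteq> 0} \<le> 1"
    using card_le_Suc0_iff_eq[of "{i\<in>A. a i \<noteq> 0}"] assms(1) by auto
  finally show "(\<Sum>i\<in>A. (a i)\<^sup>2) = ?s\<^sup>2 \<longleftrightarrow> card {i\<in>A. a i \<noteq> 0} \<le> 1" .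
qed

lemma lam_gt_1:
  assumes "0 < R" "R \<le> 1"
  shows "1 < lam R"
proof -
  have "R\<^sup>2 \<le> 1" "0 < R\<^sup>2" using assms by (auto simp: power_le_one)
  then have "0 \<le> sqrt (1 - R\<^sup>2)" "sqrt (1 - R\<^sup>2) < 1" by auto
  then show ?thesis
    unfolding lam_def by (intro less_divide_eq_1_pos[THEN iffD2]) linarith+
qed

text \<open>The maximum of \<open>(1 - \<tau>\<^sup>2) / (1 - R * \<tau>)\<close> is attained at \<open>\<tau> = (1 - sqrt (1 - R\<^sup>2)) / R\<close>,
  which is only a limit of admissible values if \<open>R = 1\<close>.\<close>

lemma lam_le_if_geometric_bounds:
  assumes R: "0 < R" "R \<le> 1"
    and N: "\<And>\<tau>. 0 \<le> \<tau> \<Longrightarrow> \<tau> < 1 \<Longrightarrow> 1 - \<tau>\<^sup>2 \<le> N * (1 - R * \<tau>)"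
  shows "lam R \<le> N"
proof (cases "R = 1")
  case True
  have "1 + \<tau> \<le> N" if "0 \<le> \<tau>" "\<tau> < 1" for \<tau>
  proof -
    have "(1 - \<tau>) * (1 + \<tau>) \<le> (1 - \<tau>) * N"
      using N[OF that] True by (simp add: power2_eq_square algebra_simps)
    then show ?thesis using that by simp
  qed
  \<comment> \<open>Letting \<open>\<tau>\<close> tend to 1 gives \<open>2 \<le> N\<close>, and
    \<open>lam 1 = 2\<close>.\<close>
  then have "\<tau> \<le> N - 1" if "0 < \<tau>" "\<tau> < 1" for \<tau>
    using that by (smt (verit))
  then have "1 \<le> N - 1"
    by (rule dense_le_bounded[of 0 1 "N - 1", rotated]) auto
  then show ?thesis by (simp add: True lam_def)
next
  case False
  define w where "w = sqrt (1 - R\<^sup>2)"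
  define t where "t = (1 - w) / R"
  have "R\<^sup>2 < 1" using R False by (simp add: abs_square_less_1)
  then have w: "w\<^sup>2 = 1 - R\<^sup>2" "0 < w" "w < 1"
    using R by (auto simp: w_def)
  have Rt: "R * t = 1 - w" using R by (simp add: t_def)
  have R2: "R\<^sup>2 = (1 - w) * (1 + w)"
    using w(1) by (simp add: algebra_simps power2_eq_square)
  have "R\<^sup>2 * t\<^sup>2 = (1 - w)\<^sup>2"
    by (simp add: Rt flip: power_mult_distrib)
  then have "(1 - w) * ((1 + w) * t\<^sup>2) = (1 - w) * (1 - w)"
    unfolding R2 by (simp only: power2_eq_square[of "1 - w"] mult.assoc)
  then have t2: "(1 + w) * t\<^sup>2 = 1 - w"
    using w by simp
  have t: "0 \<le> t" "t < 1"
  proof -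
    show "0 \<le> t" using R w by (simp add: t_def)
    have "(1 + w) * t\<^sup>2 < (1 + w) * 1" unfolding t2 using w by simp
    then have "t\<^sup>2 < 1" using w by simp
    then show "t < 1" using abs_square_less_1[of t] by simp
  qed
  \<comment> \<open>At \<open>t\<close> the denominator \<open>1 - R * t\<close> equals
    \<open>w\<close> and \<open>1 - t\<^sup>2\<close> equals \<open>2 * w / (1 + w)\<close>, so the
    quotient is \<open>lam R\<close>.\<close>
  have "(1 + w) * (1 - t\<^sup>2) \<le> (1 + w) * (N * w)"
    using N[OF t] w unfolding Rt by (intro mult_left_mono) auto
  moreover have "(1 + w) * (1 - t\<^sup>2) = 2 * w"
    using t2 by (simp add: algebra_simps)
  ultimately have "w * 2 \<le> w * (N * (1 + w))"
    by (simp add: mult_ac)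
  then have "2 \<le> N * (1 + w)"
    using w by simp
  then show ?thesis
    using w by (simp add: lam_def pos_divide_le_eq flip: w_def)
qed

theorem theorem3p7:
  fixes \<rho> :: "real ^ 'd::finite"
  assumes "\<rho> \<in> B_set - {0}"
  shows "lam (R_sum \<rho>) - norm (H_op \<rho>) \<ge> (1 - Q_quot \<rho>) * (lam (R_sum \<rho>) - 1)
    \<and> (norm (H_op \<rho>) = lam (R_sum \<rho>) \<longleftrightarrow> card {j. \<rho> $ j \<noteq> 0} \<le> 1)"
proof -
  define R where "R = R_sum \<rho>"
  define Q where "Q = Q_quot \<rho>"
  define w where "w = sqrt (1 - R\<^sup>2)"
  \<comment> \<open>The smaller root of \<open>x * (1 - x) = (R / 2)\<^sup>2\<close>, for which the
    Schur constant \<open>1 / (1 - x)\<close> is exactly \<open>lam R\<close>.\<close>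
  define x where "x = (1 - w) / 2"
  define r where "r = (\<lambda>j. \<rho> $ j / 2)"
  have \<rho>: "0 \<le> \<rho> $ j" for j using assms by (simp add: B_set_def)
  obtain i where i: "\<rho> $ i \<noteq> 0" using assms by (auto simp: vec_eq_iff)
  have R: "0 < R" "R \<le> 1"
  proof -
    have "0 < \<rho> $ i" using i \<rho>[of i] by simp
    also have "\<dots> \<le> R" unfolding R_def R_sum_def by (rule member_le_sum) (auto simp: \<rho>)
    finally show "0 < R" .
    show "R \<le> 1" using assms by (simp add: R_def R_sum_def B_set_def)
  qed
  have R2: "0 < R\<^sup>2" "R\<^sup>2 \<le> 1" using R by (auto simp: power_le_one)
  have x: "0 < x" "x < 1" "x * (1 - x) = (R / 2)\<^sup>2" "1 / (1 - x) = lam R"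
  proof -
    have w: "0 \<le> w" "w < 1" "w * w = 1 - R\<^sup>2"
      using R2 by (auto simp: w_def)
    then show "0 < x" "x < 1" unfolding x_def by auto
    show "x * (1 - x) = (R / 2)\<^sup>2"
      using w(3) by (simp add: x_def field_simps power2_eq_square)
    show "1 / (1 - x) = lam R"
      using w(1) unfolding lam_def w_def[symmetric] by (simp add: x_def field_simps)
  qed
  have sum_r: "(\<Sum>j\<in>UNIV. r j) = R / 2"
    by (simp add: r_def R_def R_sum_def sum_divide_distrib)
  have sq: "(\<Sum>j\<in>UNIV. (\<rho> $ j)\<^sup>2) = Q * R\<^sup>2"
    using R by (simp add: Q_def Q_quot_def R_def R_sum_def)
  have sum_r2: "(\<Sum>j\<in>UNIV. (r j)\<^sup>2) = Q * (\<Sum>j\<in>UNIV. r j)\<^sup>2"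
    unfolding sum_r using sq by (simp add: r_def power_divide flip: sum_divide_distrib)
  have Q: "0 \<le> Q" "Q \<le> 1" "Q = 1 \<longleftrightarrow> card {j. \<rho> $ j \<noteq> 0} \<le> 1"
  proof -
    show "0 \<le> Q" by (simp add: Q_def Q_quot_def sum_nonneg)
    have "Q * R\<^sup>2 \<le> 1 * R\<^sup>2"
      using sum_squares_le_square_sum(1)[of UNIV "\<lambda>j. \<rho> $ j"] \<rho> sq by (simp add: R_def R_sum_def)
    then show "Q \<le> 1" using R2 by simp
    have "Q = 1 \<longleftrightarrow> Q * R\<^sup>2 = R\<^sup>2" using R2 by simp
    also have "\<dots> \<longleftrightarrow> card {j. \<rho> $ j \<noteq> 0} \<le> 1"
      using sum_squares_le_square_sum(2)[of UNIV "\<lambda>j. \<rho> $ j"] \<rho> sq by (simp add: R_def R_sum_def)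
    finally show "Q = 1 \<longleftrightarrow> card {j. \<rho> $ j \<noteq> 0} \<le> 1" .
  qed
  have K: "row_finite_kernel (pascal_kernel r) (\<lambda>\<alpha>. {..multi_size \<alpha>}) (Q / (1 - x) + (1 - Q))"
    using \<rho> x Q sum_r2 by (intro row_finite_pascal_kernel) (auto simp: sum_r, auto simp: r_def)
  interpret row_finite_kernel "pascal_kernel r" "\<lambda>\<alpha>. {..multi_size \<alpha>}" "Q / (1 - x) + (1 - Q)"
    by (rule K)
  have H: "H_op \<rho> = gram"
    using has_matrix_gram by (intro H_op_eqI) (simp add: r_def pascal_kernel_gram)
  have "Q / (1 - x) = Q * lam R"
    by (simp flip: x(4))
  then have upper: "lam R - norm (H_op \<rho>) \<ge> (1 - Q) * (lam R - 1)"
    using norm_gram unfolding H by (simp add: algebra_simps)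
  have "norm (H_op \<rho>) = lam R \<longleftrightarrow> Q = 1"
  proof
    assume "norm (H_op \<rho>) = lam R"
    \<comment> \<open>Both factors are nonnegative and the second is positive, so the first must
      vanish.\<close>
    then have "(1 - Q) * (lam R - 1) \<le> 0" using upper by simp
    then show "Q = 1"
      using Q lam_gt_1[OF R] by (simp add: mult_le_0_iff)
  next
    assume "Q = 1"
    then have card: "card {j. \<rho> $ j \<noteq> 0} \<le> 1" using Q by simp
    have "\<rho> $ k = 0" if "k \<noteq> i" for k
      using card i that card_le_Suc0_iff_eq[of "{j. \<rho> $ j \<noteq> 0}"] by auto
    \<comment> \<open>With a single nonzero component, \<open>2 * r i = R\<close>, so the geometric
      vectors along direction \<open>i\<close> reach the full \<open>lam R\<close>.\<close>
    then have "R = \<rho> $ i"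
      unfolding R_def R_sum_def by (subst sum.remove[of UNIV i]) auto
    then have "1 - \<tau>\<^sup>2 \<le> norm (H_op \<rho>) * (1 - R * \<tau>)" if "0 \<le> \<tau>" "\<tau> < 1" for \<tau>
      using gram_geometric_le[OF K, of i \<tau>] that R \<rho> unfolding H by (simp add: r_def)
    then have "lam R \<le> norm (H_op \<rho>)"
      by (rule lam_le_if_geometric_bounds[OF R])
    then show "norm (H_op \<rho>) = lam R"
      using upper \<open>Q = 1\<close> by simp
  qed
  with upper Q(3) show ?thesis
    by (simp add: R_def Q_def)
qed

end
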